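(* Let $Z$ be a JB*-triple with open unit ball $B$. Let $\Gamma$ be the set of maximal tripotents of $Z$ and $\Gamma_1$ the set of unitary tripotents of $Z$. (1) If $Z$ contains a maximal tripotent then $\overline{B}=\overline{\operatorname{co}}(\Gamma)$. (2) If $Z$ contains a unitary tripotent then $\overline{B}=\overline{\operatorname{co}}(\Gamma_1)$.
   Context: A JB*-triple is a complex Banach space $Z$ with a real trilinear map $\{\cdot,\cdot,\cdot\}:Z\times Z\times Z\to Z$ such that: (i) $\{x,y,z\}$ is complex linear and symmetric in the outer variables $x,z$ and complex anti-linear in $y$; (ii) for every $x\in Z$ the map $x\square x: z\mapsto\{x,x,z\}$ is a Hermitian operator with spectrum contained in $[0,\infty)$ and $\|x\square x\|=\|x\|^2$; (iii) $\{a,b,\{x,y,z\}\}=\{\{a,b,x\},y,z\}-\{x,\{b,a,y\},z\}+\{x,y,\{a,b,z\}\}$ for all $a,b,x,y,z\in Z$. A tripotent is an element $e\in Z$ with $\{e,e,e\}=e$. It is maximal if $\{z\in Z:\{e,e,z\}=0\}=\{0\}$, and unitary if $\{e,e,z\}=z$ for all $z\in Z$ (equivalently $\{e,\{e,z,e\},e\}=z$ for all $z\in Z$). $\overline{\operatorname{co}}(S)$ denotes the norm-closed convex hull of $S$. *)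

theory Defs
  imports "HOL-Analysis.Analysis"
begin

text \<open>
  Complex Banach spaces: a complex scalar multiplication on a real Banach space
  which extends the real one and for which the norm is homogeneous.
\<close>

locale complex_banach = vector_space scaleC
  for scaleC :: "complex \<Rightarrow> 'a::banach \<Rightarrow> 'a" (infixr \<open>*\<^sub>c\<close> 75) +
  assumes scaleC_of_real: "complex_of_real r *\<^sub>c x = r *\<^sub>R x"
    and norm_scaleC: "norm (c *\<^sub>c x) = cmod c * norm x"

definition bounded_clinear :: "(complex \<Rightarrow> 'a::banach \<Rightarrow> 'a) \<Rightarrow> ('a \<Rightarrow> 'a) \<Rightarrow> bool" where
  "bounded_clinear scaleC T \<longleftrightarrow> Vector_Spaces.linear scaleC scaleC T \<and> bounded_linear T"

definition op_exp :: "('a::banach \<Rightarrow> 'a) \<Rightarrow> 'a \<Rightarrow> 'a" where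
  "op_exp T x = (\<Sum>n. (T ^^ n) x /\<^sub>R fact n)"

text \<open>
  A bounded operator \<open>T\<close> on a complex Banach space is Hermitian if \<open>exp (i t T)\<close> is an
  isometry for every real \<open>t\<close>. As \<open>T\<close> is bounded, the series of \<open>op_exp\<close> converges
  absolutely at every point.
\<close>

definition hermitian_op :: "(complex \<Rightarrow> 'a::banach \<Rightarrow> 'a) \<Rightarrow> ('a \<Rightarrow> 'a) \<Rightarrow> bool" where
  "hermitian_op scaleC T \<longleftrightarrow> bounded_clinear scaleC T \<and>
     (\<forall>(t::real) x. norm (op_exp (\<lambda>z. scaleC (\<i> * complex_of_real t) (T z)) x) = norm x)"

definition op_spectrum :: "(complex \<Rightarrow> 'a::banach \<Rightarrow> 'a) \<Rightarrow> ('a \<Rightarrow> 'a) \<Rightarrow> complex set" where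
  "op_spectrum scaleC T =
     {\<mu>. \<not> (\<exists>S. bounded_clinear scaleC S \<and>
              (\<forall>x. S (T x - scaleC \<mu> x) = x) \<and> (\<forall>x. T (S x) - scaleC \<mu> (S x) = x))}"

text \<open>
  Linearity in the first variable follows from \<open>triple_linear\<close> and \<open>triple_commute\<close>.
  The library norm \<open>onorm\<close> is meaningful only for bounded operators; boundedness of
  \<open>\<lambda>z. triple x x z\<close> is part of \<open>box_hermitian\<close>.
\<close>

locale jb_triple = complex_banach scaleC
  for scaleC :: "complex \<Rightarrow> 'a::banach \<Rightarrow> 'a" (infixr \<open>*\<^sub>c\<close> 75) +
  fixes triple :: "'a \<Rightarrow> 'a \<Rightarrow> 'a \<Rightarrow> 'a"
  assumes triple_linear: "Vector_Spaces.linear scaleC scaleC (\<lambda>z. triple x y z)"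
    and triple_commute: "triple x y z = triple z y x"
    and triple_add_mid: "triple x (y + y') z = triple x y z + triple x y' z"
    and triple_scaleC_mid: "triple x (c *\<^sub>c y) z = cnj c *\<^sub>c triple x y z"
    and box_hermitian: "hermitian_op scaleC (\<lambda>z. triple x x z)"
    and box_spectrum: "op_spectrum scaleC (\<lambda>z. triple x x z) \<subseteq> complex_of_real ` {0..}"
    and box_norm: "onorm (\<lambda>z. triple x x z) = (norm x)\<^sup>2"
    and jordan_identity: "triple a b (triple x y z) =
      triple (triple a b x) y z - triple x (triple b a y) z + triple x y (triple a b z)"

definition tripotent :: "('a \<Rightarrow> 'a \<Rightarrow> 'a \<Rightarrow> 'a) \<Rightarrow> 'a \<Rightarrow> bool" where
  "tripotent triple e \<longleftrightarrow> triple e e e = e"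

definition maximal_tripotent :: "('a::zero \<Rightarrow> 'a \<Rightarrow> 'a \<Rightarrow> 'a) \<Rightarrow> 'a \<Rightarrow> bool" where
  "maximal_tripotent triple e \<longleftrightarrow> tripotent triple e \<and> {z. triple e e z = 0} = {0}"

definition unitary_tripotent :: "('a \<Rightarrow> 'a \<Rightarrow> 'a \<Rightarrow> 'a) \<Rightarrow> 'a \<Rightarrow> bool" where
  "unitary_tripotent triple e \<longleftrightarrow> tripotent triple e \<and> (\<forall>z. triple e e z = z)"

end

theory Submission
  imports Defs "HOL-Computational_Algebra.Polynomial"
begin

text \<open>
  Why the theorem is true.  Let \<open>\<Gamma>\<close> be the set of maximal (or of unitary) tripotents.  Tripotents
  have norm at most 1 (\<open>norm_tripotent_le_1\<close>), so only the inclusion of the open unit ball \<open>B\<close> in the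
  closed convex hull of \<open>\<Gamma>\<close> needs work.  For \<open>b \<in> B\<close> there is a Moebius map \<open>g\<close> of \<open>B\<close> that sends \<open>0\<close>
  to \<open>b\<close> and \<open>\<Gamma>\<close> to \<open>\<Gamma>\<close>; by the mean value property of the holomorphic function \<open>c \<mapsto> g (c e)\<close> the point
  \<open>b = g 0\<close> is the mean of the points \<open>g (c e) \<in> \<Gamma>\<close> over the unit circle.

  Such a map arises as the flow of vector fields \<open>z \<mapsto> a - {z, a, z}\<close>, and the proof below replaces the
  flow by Euler's method.

  \<^item> The fields can be chosen, depending on time, so that the Euler polygon that starts at \<open>0\<close>
    follows the segment from \<open>0\<close> to \<open>b\<close> without any error (\<open>radial_vector_field\<close>).

  \<^item> Every Euler step is a quadratic polynomial, so \<open>n\<close> steps applied to \<open>c e\<close> give a polynomial in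
    \<open>c\<close>, and the mean value property reduces to a finite average over roots of unity
    (\<open>polynomial_curve_mean\<close>).  Thus \<open>b\<close> is the average of end points of polygons that start in \<open>\<Gamma>\<close>.

  \<^item> The fields are tangent to \<open>\<Gamma>\<close>, so a step of size \<open>h\<close> from a point of \<open>\<Gamma>\<close> ends within \<open>O(h\<^sup>2)\<close>
    of \<open>\<Gamma>\<close> (\<open>maximal_near_tangent\<close>), and \<open>n\<close> steps of size \<open>1/n\<close> end within \<open>O(1/n)\<close> (\<open>euler_near\<close>).
    Tangency holds by the Peirce relations of a maximal tripotent (\<open>tangent_maximal\<close>); actual
    tripotents near a tangent vector come from an iteration that converges quadratically
    (\<open>tripotent_near_almost_tripotent\<close>), and they are again maximal (or unitary) because these
    properties are open among tripotents.

  Letting \<open>n\<close> tend to infinity shows that \<open>b\<close> lies in the closed convex hull of \<open>\<Gamma>\<close>.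
\<close>

context jb_triple
begin

section \<open>Trilinearity and continuity of the triple product\<close>

lemma triple_add_right: "triple x y (z + z') = triple x y z + triple x y z'"
  and triple_scaleC_right: "triple x y (c *\<^sub>c z) = c *\<^sub>c triple x y z"
  using triple_linear[of x y] by (auto simp: Vector_Spaces.linear_iff)

lemma triple_add_left: "triple (x + x') y z = triple x y z + triple x' y z"
  by (metis triple_add_right triple_commute)

lemma triple_scaleC_left: "triple (c *\<^sub>c x) y z = c *\<^sub>c triple x y z"
  by (metis triple_scaleC_right triple_commute)

lemma triple_scaleR_left: "triple (r *\<^sub>R x) y z = r *\<^sub>R triple x y z"
  and triple_scaleR_mid: "triple x (r *\<^sub>R y) z = r *\<^sub>R triple x y z"
  and triple_scaleR_right: "triple x y (r *\<^sub>R z) = r *\<^sub>R triple x y z"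
  by (simp_all flip: scaleC_of_real
      add: triple_scaleC_left triple_scaleC_mid triple_scaleC_right)

lemma triple_zero [simp]: "triple 0 y z = 0" "triple x 0 z = 0" "triple x y 0 = 0"
  using triple_scaleR_left[of 0 0 y z] triple_scaleR_mid[of x 0 0 z]
    triple_scaleR_right[of x y 0 0] by simp_all

lemma triple_minus_left: "triple (- x) y z = - triple x y z"
  and triple_minus_mid: "triple x (- y) z = - triple x y z"
  and triple_minus_right: "triple x y (- z) = - triple x y z"
  using triple_scaleR_left[of "-1" x y z] triple_scaleR_mid[of x "-1" y z]
    triple_scaleR_right[of x y "-1" z] by simp_all

lemma triple_diff_left: "triple (x - x') y z = triple x y z - triple x' y z"
  and triple_diff_mid: "triple x (y - y') z = triple x y z - triple x y' z"
  and triple_diff_right: "triple x y (z - z') = triple x y z - triple x y z'"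
  using triple_add_left[of x "- x'"] triple_add_mid[of x y "- y'"] triple_add_right[of x y z "- z'"]
  by (simp_all add: triple_minus_left triple_minus_mid triple_minus_right)

lemmas triple_simps =
  triple_add_left triple_add_mid triple_add_right
  triple_diff_left triple_diff_mid triple_diff_right
  triple_minus_left triple_minus_mid triple_minus_right
  triple_scaleR_left triple_scaleR_mid triple_scaleR_right

lemma norm_box_le: "norm (triple x x z) \<le> (norm x)\<^sup>2 * norm z"
  using onorm[of "\<lambda>z. triple x x z" z] box_norm[of x] box_hermitian[of x]
  by (simp add: hermitian_op_def bounded_clinear_def)

text \<open>
  The axioms control only the diagonal operators \<open>z \<mapsto> {x, x, z}\<close>; since the product is sesquilinear
  in its first two arguments, polarisation carries the control over to \<open>{x, y, z}\<close>.
\<close>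

lemma triple_polarisation:
  "4 *\<^sub>R triple x y z = triple (x + y) (x + y) z - triple (x - y) (x - y) z
     + \<i> *\<^sub>c (triple (x + \<i> *\<^sub>c y) (x + \<i> *\<^sub>c y) z - triple (x - \<i> *\<^sub>c y) (x - \<i> *\<^sub>c y) z)"
proof -
  have ii: "\<i> * (2 * \<i>) = - 2" by (simp add: complex_eq_iff)
  have "triple (x + \<i> *\<^sub>c y) (x + \<i> *\<^sub>c y) z - triple (x - \<i> *\<^sub>c y) (x - \<i> *\<^sub>c y) z
    = 2 *\<^sub>R (\<i> *\<^sub>c triple y x z) - 2 *\<^sub>R (\<i> *\<^sub>c triple x y z)"
    by (simp add: triple_simps triple_scaleC_left triple_scaleC_mid scale_right_distrib
        scale_right_diff_distrib scaleR_2)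
  then have "\<i> *\<^sub>c (triple (x + \<i> *\<^sub>c y) (x + \<i> *\<^sub>c y) z - triple (x - \<i> *\<^sub>c y) (x - \<i> *\<^sub>c y) z)
    = 2 *\<^sub>R triple x y z - 2 *\<^sub>R triple y x z"
    by (simp add: ii scale_right_diff_distrib scale_right_distrib flip: scaleC_of_real)
  moreover have "triple (x + y) (x + y) z - triple (x - y) (x - y) z
    = 2 *\<^sub>R triple x y z + 2 *\<^sub>R triple y x z"
    by (simp add: triple_simps scaleR_2)
  moreover have "4 *\<^sub>R triple x y z = 2 *\<^sub>R triple x y z + 2 *\<^sub>R triple x y z"
    by (simp flip: scaleR_add_left)
  ultimately show ?thesis by simp
qed

text \<open>
  Continuity of the product in all three arguments.  For unit vectors \<open>x\<close>, \<open>y\<close> the polarisation formula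
  for \<open>4 {x, y, z}\<close> has four terms, each with a diagonal argument of norm at most 2 and hence of norm
  at most \<open>4 \<parallel>z\<parallel>\<close>; this is where the constant 4 comes from.
\<close>

lemma norm_triple_le: "norm (triple x y z) \<le> 4 * norm x * norm y * norm z"
proof (cases "x = 0 \<or> y = 0")
  case False
  define u v where "u = x /\<^sub>R norm x" and "v = y /\<^sub>R norm y"
  have uv: "norm u = 1" "norm v = 1" "x = norm x *\<^sub>R u" "y = norm y *\<^sub>R v"
    using False by (auto simp: u_def v_def)
  have box: "norm (triple w w z) \<le> 4 * norm z" if "norm w \<le> 2" for w
    using norm_box_le[of w z] power_mono[OF that norm_ge_zero, of 2]
      mult_right_mono[of "(norm w)\<^sup>2" 4 "norm z"] by simp
  have iv: "norm (\<i> *\<^sub>c v) = 1" by (simp add: norm_scaleC uv)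
  have "norm (4 *\<^sub>R triple u v z) \<le> norm (triple (u + v) (u + v) z) + norm (triple (u - v) (u - v) z)
      + (norm (triple (u + \<i> *\<^sub>c v) (u + \<i> *\<^sub>c v) z) + norm (triple (u - \<i> *\<^sub>c v) (u - \<i> *\<^sub>c v) z))"
    unfolding triple_polarisation
    by (intro order_trans[OF norm_triangle_ineq] add_mono norm_triangle_ineq4)
      (simp add: norm_scaleC norm_triangle_ineq4)
  also have "\<dots> \<le> 4 * norm z + 4 * norm z + (4 * norm z + 4 * norm z)"
    using norm_triangle_ineq[of u v] norm_triangle_ineq4[of u v]
      norm_triangle_ineq[of u "\<i> *\<^sub>c v"] norm_triangle_ineq4[of u "\<i> *\<^sub>c v"]
    by (intro add_mono box) (auto simp: uv iv)
  finally have "norm (triple u v z) \<le> 4 * norm z" by simp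
  then have "norm x * norm y * norm (triple u v z) \<le> norm x * norm y * (4 * norm z)"
    by (intro mult_left_mono) auto
  moreover have "norm (triple x y z) = norm x * norm y * norm (triple u v z)"
    by (subst uv(3), subst uv(4)) (simp add: triple_simps)
  ultimately show ?thesis by (simp add: mult_ac)
qed auto

lemma norm_triple_le':
  assumes "norm x \<le> A" "norm y \<le> B" "norm z \<le> C"
  shows "norm (triple x y z) \<le> 4 * A * B * C"
proof -
  have "norm x * norm y \<le> A * B" "0 \<le> A"
    using assms mult_mono norm_ge_zero order_trans by metis+
  then have "norm x * norm y * norm z \<le> A * B * C"
    using assms mult_mono[of "norm x * norm y" "A * B" "norm z" C]
      by (smt (verit) mult_nonneg_nonneg norm_ge_zero)
  with norm_triple_le[of x y z] show ?thesis by simp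
qed

lemma bounded_linear_triple_mid: "bounded_linear (\<lambda>y. triple x y z)"
proof (rule bounded_linear_intro[where K = "4 * norm x * norm z"])
  show "norm (triple x y z) \<le> norm y * (4 * norm x * norm z)" for y
    using norm_triple_le[of x y z] by (simp only: mult_ac)
qed (simp_all only: triple_simps)

lemma tendsto_triple_diag:
  assumes "(f \<longlongrightarrow> l) F"
  shows "((\<lambda>t. triple (f t) (f t) (f t)) \<longlongrightarrow> triple l l l) F"
proof -
  have le: "norm (triple (f t) (f t) (f t) - triple l l l)
      \<le> 4 * norm (f t - l) * norm (f t) * norm (f t)
        + 4 * norm l * norm (f t - l) * norm (f t) + 4 * norm l * norm l * norm (f t - l)" for t
  proof -
    have "triple (f t) (f t) (f t) - triple l l l
      = triple (f t - l) (f t) (f t) + triple l (f t - l) (f t) + triple l l (f t - l)"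
      by (simp add: triple_simps)
    then show ?thesis
      by (simp only:) (intro norm_triangle_mono norm_triple_le)
  qed
  have d: "((\<lambda>t. f t - l) \<longlongrightarrow> 0) F" using assms by (rule LIM_zero)
  have "((\<lambda>t. 4 * norm (f t - l) * norm (f t) * norm (f t)
        + 4 * norm l * norm (f t - l) * norm (f t) + 4 * norm l * norm l * norm (f t - l))
     \<longlongrightarrow> 4 * norm (0::'a) * norm l * norm l
        + 4 * norm l * norm (0::'a) * norm l + 4 * norm l * norm l * norm (0::'a)) F"
    by (intro tendsto_intros assms d)
  then have "((\<lambda>t. triple (f t) (f t) (f t) - triple l l l) \<longlongrightarrow> 0) F"
    by (intro Lim_null_comparison[OF always_eventually[OF allI[OF le]]]) simp
  then show ?thesis by (rule LIM_zero_cancel)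
qed

section \<open>Odd powers\<close>

definition opow :: "'a \<Rightarrow> nat \<Rightarrow> 'a" where
  "opow x k = ((\<lambda>z. triple x x z) ^^ k) x"

lemma opow_0 [simp]: "opow x 0 = x"
  and opow_Suc: "opow x (Suc k) = triple x x (opow x k)"
  by (simp_all add: opow_def)

text \<open>
  Power associativity.  Write \<open>D i j\<close> for the operator \<open>z \<mapsto> {x\<^sub>i, x\<^sub>j, z}\<close> on odd powers of \<open>x\<close>, and
  suppose that \<open>D i j\<close> is one operator \<open>D\<^sub>N\<close> for all \<open>i + j = N\<close>.  The Jordan identity gives
  \<open>[D\<^sub>0, D\<^sub>N] = D (i+1) j - D i (j+1)\<close>, and adding this up over \<open>i\<close> yields
  \<open>(N+1) [D\<^sub>0, D\<^sub>N] = D (N+1) 0 - D 0 (N+1)\<close>.  The same identity with the roles of the two operators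
  exchanged evaluates the right-hand side as \<open>[D\<^sub>N, D\<^sub>0]\<close>.  So \<open>(N+2) [D\<^sub>0, D\<^sub>N] = 0\<close>, the operators
  commute, and \<open>D (i+1) j = D i (j+1)\<close>.
\<close>

lemma triple_opow_shift:
  assumes "i + j = N"
  shows "triple (opow x i) (opow x j) z = triple (opow x N) x z"
  using assms
proof (induction N arbitrary: i j z)
  case 0
  then show ?case by simp
next
  case (Suc N)
  define D where "D n z = triple (opow x n) x z" for n z
  have IH: "triple (opow x i) (opow x j) z = D N z" if "i + j = N" for i j z
    using Suc.IH[OF that] by (simp add: D_def)
  have D0: "D 0 z = triple x x z" for z by (simp add: D_def)
  have comm1: "D 0 (D N z) - D N (D 0 z)
      = triple (opow x (Suc i)) (opow x j) z - triple (opow x i) (opow x (Suc j)) z"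
    if "i + j = N" for i j z
    using jordan_identity[of x x "opow x i" "opow x j" z]
    by (simp add: IH[OF that] D0 opow_Suc)
  have sum: "real i *\<^sub>R (D 0 (D N z) - D N (D 0 z))
      = triple (opow x i) (opow x (Suc N - i)) z - triple x (opow x (Suc N)) z" if "i \<le> Suc N" for i z
    using that
  proof (induction i)
    case (Suc i)
    then show ?case using comm1[of i "N - i" z]
      by (simp add: Suc_diff_le scaleR_add_left)
  qed simp
  have "triple x (opow x N) x = opow x (Suc N)"
    using IH[of 0 N x] by (simp add: D_def opow_Suc triple_commute[of "opow x N"])
  then have "D N (D 0 z) - D 0 (D N z) = triple (opow x (Suc N)) x z - triple x (opow x (Suc N)) z" for z
    using jordan_identity[of "opow x N" x x x z]
    by (simp add: D_def opow_Suc triple_commute[of "opow x N"])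
  with sum[of "Suc N"] have "real (Suc N) *\<^sub>R (D 0 (D N z) - D N (D 0 z)) = - (D 0 (D N z) - D N (D 0 z))" for z
    by simp
  then have "real (Suc (Suc N)) *\<^sub>R (D 0 (D N z) - D N (D 0 z)) = 0" for z
    by (metis (no_types, lifting) add.commute add.right_inverse of_nat_Suc scaleR_left_distrib scaleR_one)
  then have "D 0 (D N z) = D N (D 0 z)" for z
    by (simp del: of_nat_Suc)
  with sum[of i] sum[of "Suc N"] Suc.prems show ?case
    by (metis add_diff_cancel_left' diff_self diff_self_eq_0 eq_iff_diff_eq_0 le_add1 opow_0 order_refl scaleR_zero_right)
qed

lemma triple_opow: "triple (opow x i) (opow x j) (opow x k) = opow x (Suc (i + j + k))"
proof -
  have "triple (opow x i) (opow x j) (opow x k) = triple (opow x 0) (opow x (i + j)) (opow x k)"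
    using triple_opow_shift[of i j "i + j"] triple_opow_shift[of 0 "i + j" "i + j"] by simp
  also have "\<dots> = triple (opow x k) (opow x (i + j)) x"
    by (simp add: triple_commute)
  also have "\<dots> = triple (opow x (i + j + k)) x x"
    using triple_opow_shift[of k "i + j" "i + j + k"] by simp
  also have "\<dots> = opow x (Suc (i + j + k))"
    by (simp add: opow_Suc triple_commute)
  finally show ?thesis .
qed

text \<open>
  This is \<open>p(D) x\<close> for the operator \<open>D z = {x, x, z}\<close>, that is, the odd function \<open>s \<mapsto> s p(s\<^sup>2)\<close> applied to
  \<open>x\<close>.  All identities between odd powers of one element thereby become identities of polynomials.
\<close>

definition odd_calculus :: "'a \<Rightarrow> real poly \<Rightarrow> 'a" where
  "odd_calculus x p = fold_coeffs (\<lambda>c v. c *\<^sub>R x + triple x x v) p 0"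

lemma odd_calculus_0 [simp]: "odd_calculus x 0 = 0"
  by (simp add: odd_calculus_def)

lemma odd_calculus_pCons [simp]:
  "odd_calculus x (pCons c p) = c *\<^sub>R x + triple x x (odd_calculus x p)"
  by (cases "c = 0 \<and> p = 0") (auto simp: odd_calculus_def)

lemma odd_calculus_add: "odd_calculus x (p + q) = odd_calculus x p + odd_calculus x q"
  by (induction p q rule: poly_induct2) (auto simp: scaleR_add_left triple_simps)

lemma odd_calculus_smult: "odd_calculus x (smult c p) = c *\<^sub>R odd_calculus x p"
  by (induction p) (auto simp: scaleR_add_right triple_simps)

lemma odd_calculus_diff: "odd_calculus x (p - q) = odd_calculus x p - odd_calculus x q"
  using odd_calculus_add[of x "p - q" q] by simp

lemma odd_calculus_monom: "odd_calculus x (monom c k) = c *\<^sub>R opow x k"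
  by (induction k) (auto simp: monom_0 monom_Suc opow_Suc triple_simps)

lemma poly_induct_monom:
  assumes "\<And>c k. P (monom c k)" and "\<And>p q. P p \<Longrightarrow> P q \<Longrightarrow> P (p + q)"
  shows "P (p :: 'b::comm_monoid_add poly)"
proof -
  have "P (\<Sum>i\<in>A. monom (coeff p i) i)" if "finite A" for A
    using that
  proof (induction A)
    case empty
    then show ?case using assms(1)[of 0 0] by simp
  next
    case (insert i A)
    then show ?case using assms by simp
  qed
  from this[of "{..degree p}"] show ?thesis
    by (simp add: poly_as_sum_of_monoms)
qed

text \<open>
  The product of three odd functions \<open>s p(s\<^sup>2)\<close>, \<open>s q(s\<^sup>2)\<close>, \<open>s r(s\<^sup>2)\<close> is \<open>s \<cdot> s\<^sup>2 (p q r)(s\<^sup>2)\<close>, which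
  explains the additional factor \<open>pCons 0\<close>.  By linearity it suffices to look at monomials, where
  the claim is power associativity.
\<close>

lemma triple_odd_calculus:
  "triple (odd_calculus x p) (odd_calculus x q) (odd_calculus x r)
     = odd_calculus x (pCons 0 (p * q * r))"
proof (induction p rule: poly_induct_monom)
  case (1 a i)
  show ?case
  proof (induction q rule: poly_induct_monom)
    case (1 b j)
    show ?case
    proof (induction r rule: poly_induct_monom)
      case (1 c k)
      have "pCons 0 (monom a i * monom b j * monom c k) = monom (a * b * c) (Suc (i + j + k))"
        by (simp add: mult_monom monom_Suc)
      then show ?case
        by (simp only: odd_calculus_monom triple_simps triple_opow scaleR_scaleR mult_ac)
    next
      case (2 r r')
      then show ?case by (simp add: triple_simps odd_calculus_add distrib_left)
    qed
  next
    case (2 q q')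
    then show ?case
      by (simp add: triple_simps odd_calculus_add distrib_left distrib_right)
  qed
next
  case (2 p p')
  then show ?case by (simp add: triple_simps odd_calculus_add distrib_right)
qed

lemma norm_odd_calculus_bounded: "\<exists>K\<ge>0. \<forall>x. norm x \<le> R \<longrightarrow> norm (odd_calculus x p) \<le> K"
proof (induction p)
  case 0
  show ?case by (intro exI[of _ 0]) simp
next
  case (pCons c p)
  then obtain K where K: "K \<ge> 0" "\<And>x. norm x \<le> R \<Longrightarrow> norm (odd_calculus x p) \<le> K" by blast
  have "norm (odd_calculus x (pCons c p)) \<le> \<bar>c\<bar> * \<bar>R\<bar> + R\<^sup>2 * K" if "norm x \<le> R" for x
  proof -
    have "norm (triple x x (odd_calculus x p)) \<le> (norm x)\<^sup>2 * norm (odd_calculus x p)"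
      by (rule norm_box_le)
    also have "\<dots> \<le> R\<^sup>2 * K"
      using that K by (intro mult_mono power_mono) auto
    finally show ?thesis
      using that unfolding odd_calculus_pCons
      by (intro order_trans[OF norm_triangle_ineq] add_mono) (auto intro!: mult_left_mono)
  qed
  then show ?case using K by (intro exI[of _ "\<bar>c\<bar> * \<bar>R\<bar> + R\<^sup>2 * K"]) auto
qed

lemma norm_opow_le: "norm (opow x k) \<le> norm x ^ (2 * k + 1)"
proof (induction k)
  case (Suc k)
  have "norm (opow x (Suc k)) \<le> (norm x)\<^sup>2 * norm (opow x k)"
    by (simp add: opow_Suc norm_box_le)
  also have "\<dots> \<le> (norm x)\<^sup>2 * norm x ^ (2 * k + 1)"
    using Suc by (intro mult_left_mono) auto
  finally show ?case by (simp add: power2_eq_square mult.assoc)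
qed simp

section \<open>Peirce relations and the norm of a tripotent\<close>

lemma scaleR_3: "3 *\<^sub>R v = v + v + (v :: 'b::real_vector)"
proof -
  have "(3::real) = 1 + 1 + 1" by simp
  then show ?thesis by (simp only: scaleR_add_left scaleR_one)
qed

text \<open>
  With \<open>D z = {e, e, z}\<close> and \<open>Q z = {e, z, e}\<close>, two instances of the Jordan identity read
  \<open>D Q = 2 Q - Q D\<close> and \<open>Q = 2 D Q - Q D\<close>; their difference gives \<open>3 (D Q - Q) = 0\<close>.
\<close>

lemma peirce_box_quad:
  assumes "tripotent triple e"
  shows "triple e e (triple e z e) = triple e z e"
    and "triple e (triple e e z) e = triple e z e"
proof -
  have e: "triple e e e = e" using assms by (simp add: tripotent_def)
  have 1: "triple e e (triple e z e) = 2 *\<^sub>R triple e z e - triple e (triple e e z) e"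
    using jordan_identity[of e e e z e] by (simp add: e scaleR_2 algebra_simps)
  have 2: "triple e z e = 2 *\<^sub>R triple e e (triple e z e) - triple e (triple e e z) e"
    using jordan_identity[of e z e e e]
    by (simp add: e scaleR_2 triple_commute[of z e e] triple_commute[of "triple e z e" e e] algebra_simps)
  have "3 *\<^sub>R (triple e e (triple e z e) - triple e z e) = 0"
  proof -
    have "triple e (triple e e z) e = 2 *\<^sub>R triple e z e - triple e e (triple e z e)"
      using 1 by simp
    with 2 show ?thesis
      unfolding scaleR_3 scaleR_2 by (simp add: algebra_simps)
  qed
  then show 3: "triple e e (triple e z e) = triple e z e" by simp
  show "triple e (triple e e z) e = triple e z e"
    using 1 3 by (simp add: scaleR_2)
qed

lemma peirce_quad_quad:
  assumes "tripotent triple e"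
  shows "triple e (triple e z e) e = 2 *\<^sub>R triple e e (triple e e z) - triple e e z"
proof -
  have e: "triple e e e = e" using assms by (simp add: tripotent_def)
  have "triple e e z = 2 *\<^sub>R triple e e (triple e e z) - triple e (triple e z e) e"
    using jordan_identity[of z e e e e]
    by (simp add: e scaleR_2 triple_commute[of z e e] triple_commute[of "triple e e z" e e] algebra_simps)
  then show ?thesis by (simp add: algebra_simps)
qed

text \<open>
  The eigenvalues of \<open>D\<close> are among 0, 1/2 and 1: substitute \<open>Q\<^sup>2 = 2 D\<^sup>2 - D\<close> in \<open>D Q\<^sup>2 = Q\<^sup>2\<close>.
\<close>

lemma peirce_box_cubic:
  assumes "tripotent triple e"
  shows "2 *\<^sub>R triple e e (triple e e (triple e e z)) = 3 *\<^sub>R triple e e (triple e e z) - triple e e z"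
proof -
  have "triple e e (triple e (triple e z e) e) = triple e (triple e z e) e"
    by (rule peirce_box_quad[OF assms])
  then have "2 *\<^sub>R triple e e (triple e e (triple e e z)) - triple e e (triple e e z)
    = 2 *\<^sub>R triple e e (triple e e z) - triple e e z"
    by (simp only: peirce_quad_quad[OF assms] triple_simps)
  then show ?thesis
    by (simp add: scaleR_3 scaleR_2 algebra_simps)
qed

text \<open>
  On eigenvectors the exponential series can be summed explicitly.  Three of them are enough to
  evaluate the exponential of \<open>z \<mapsto> {e, e, z}\<close> for a tripotent \<open>e\<close>, because every element is the sum of
  its three Peirce components.
\<close>

lemma op_exp_eigen_sum:
  assumes "\<And>z z'. S (z + z') = S z + S z'" and "\<And>c z. S (c *\<^sub>c z) = c *\<^sub>c S z"
    and "S x = \<alpha> *\<^sub>c x" "S y = \<mu> *\<^sub>c y" "S z = \<nu> *\<^sub>c z"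
  shows "op_exp S (x + y + z) = exp \<alpha> *\<^sub>c x + exp \<mu> *\<^sub>c y + exp \<nu> *\<^sub>c z"
proof -
  have eig: "(S ^^ n) u = \<kappa> ^ n *\<^sub>c u" if "S u = \<kappa> *\<^sub>c u" for \<kappa> u n
    by (induction n) (simp_all add: assms(2) that mult.commute)
  have add: "(S ^^ n) (u + v) = (S ^^ n) u + (S ^^ n) v" for u v n
    by (induction n) (simp_all add: assms(1))
  have sums: "(\<lambda>n. (\<kappa> ^ n *\<^sub>c u) /\<^sub>R fact n) sums (exp \<kappa> *\<^sub>c u)" for \<kappa> u
  proof -
    have "bounded_linear (\<lambda>c. c *\<^sub>c u)"
    proof (rule bounded_linear_intro)
      show "(r *\<^sub>R c) *\<^sub>c u = r *\<^sub>R (c *\<^sub>c u)" for r c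
        by (simp add: scaleR_conv_of_real flip: scaleC_of_real)
      show "norm (c *\<^sub>c u) \<le> norm c * norm u" for c by (simp add: norm_scaleC)
    qed (simp add: scale_left_distrib)
    moreover have "(\<lambda>n. \<kappa> ^ n /\<^sub>R fact n) sums exp \<kappa>"
      by (rule exp_converges)
    ultimately have "(\<lambda>n. (\<kappa> ^ n /\<^sub>R fact n) *\<^sub>c u) sums (exp \<kappa> *\<^sub>c u)"
      by (rule bounded_linear.sums)
    then show ?thesis
      by (simp add: scaleR_conv_of_real flip: scaleC_of_real)
  qed
  have "(\<lambda>n. (S ^^ n) (x + y + z) /\<^sub>R fact n) sums (exp \<alpha> *\<^sub>c x + exp \<mu> *\<^sub>c y + exp \<nu> *\<^sub>c z)"
    unfolding add eig[OF assms(3)] eig[OF assms(4)] eig[OF assms(5)] scaleR_add_right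
    by (intro sums_add sums)
  then show ?thesis unfolding op_exp_def by (simp add: sums_iff)
qed

text \<open>
  The eigenvalues 0, 1/2, 1 of \<open>T z = {e, e, z}\<close> are all that is needed to bound the norm of this
  Hermitian operator.  The isometries \<open>U = exp (i \<pi> T)\<close> and \<open>V = exp (- i \<pi> T)\<close> act on the three
  eigenspaces by \<open>1, i, -1\<close> and \<open>1, -i, -1\<close>.  Hence \<open>U + V = 2 (1 - 2 T)\<close>, so \<open>1 - 2 T\<close> and then \<open>T\<close> are
  contractions, and \<open>\<parallel>e\<parallel>\<^sup>2 = \<parallel>T\<parallel> \<le> 1\<close>.
\<close>

lemma norm_tripotent_le_1:
  assumes "tripotent triple e"
  shows "norm e \<le> 1"
proof -
  define T where "T z = triple e e z" for z
  have T: "T (u + v) = T u + T v" "T (u - v) = T u - T v" "T (c *\<^sub>c u) = c *\<^sub>c T u"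
    "T (r *\<^sub>R u) = r *\<^sub>R T u" for u v c r
    by (simp_all add: T_def triple_simps triple_scaleC_right)
  have cubic: "2 *\<^sub>R T (T (T z)) = 3 *\<^sub>R T (T z) - T z" for z
    using peirce_box_cubic[OF assms] by (simp add: T_def)
  have le: "norm (T x) \<le> norm x" for x
  proof -
    \<comment> \<open>The Peirce decomposition of \<open>x\<close> into eigenvectors for 1, 1/2 and 0.\<close>
    define x2 x1 x0 where "x2 = 2 *\<^sub>R T (T x) - T x" and "x1 = 4 *\<^sub>R (T x - T (T x))"
      and "x0 = x - x1 - x2"
    have x: "x = x0 + x1 + x2" by (simp add: x0_def)
    have T3: "2 *\<^sub>R T (T (T x)) = 2 *\<^sub>R T (T x) + T (T x) - T x"
      using cubic[of x] by (simp add: scaleR_3 scaleR_2)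
    have T2: "T x2 = x2"
      by (simp add: x2_def T T3)
    have "2 *\<^sub>R T x1 = 4 *\<^sub>R (2 *\<^sub>R T (T x) - 2 *\<^sub>R T (T (T x)))"
      by (simp add: x1_def T scaleR_right_diff_distrib)
    also have "\<dots> = x1"
      by (simp add: x1_def T3)
    finally have "(1/2) *\<^sub>R (2 *\<^sub>R T x1) = (1/2) *\<^sub>R x1" by (rule arg_cong)
    then have T1: "T x1 = (1/2) *\<^sub>R x1" by simp
    have T0: "T x0 = 0"
      using T1 T2 by (simp add: x0_def T) (simp add: x1_def x2_def scaleR_2 algebra_simps)
    have iso: "norm (exp 0 *\<^sub>c x0 + exp (\<i> * complex_of_real t * (1/2)) *\<^sub>c x1
        + exp (\<i> * complex_of_real t) *\<^sub>c x2) = norm x" for t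
    proof -
      have "op_exp (\<lambda>z. (\<i> * complex_of_real t) *\<^sub>c T z) (x0 + x1 + x2)
         = exp 0 *\<^sub>c x0 + exp (\<i> * complex_of_real t * (1/2)) *\<^sub>c x1
        + exp (\<i> * complex_of_real t) *\<^sub>c x2"
        by (rule op_exp_eigen_sum)
          (simp_all add: T scale_right_distrib T0 T1 T2 mult_ac flip: scaleC_of_real)
      then show ?thesis
        using box_hermitian[of e] unfolding hermitian_op_def T_def by (metis x)
    qed
    have "exp (\<i> * complex_of_real pi * (1/2)) = \<i>" "exp (\<i> * complex_of_real (- pi) * (1/2)) = - \<i>"
      "exp (\<i> * complex_of_real pi) = -1" "exp (\<i> * complex_of_real (- pi)) = -1"
      by (simp_all add: exp_eq_polar complex_eq_iff flip: cis_conv_exp)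
    with iso[of pi] iso[of "- pi"] have "norm (x0 + \<i> *\<^sub>c x1 - x2) = norm x" "norm (x0 - \<i> *\<^sub>c x1 - x2) = norm x"
      by simp_all
    then have "norm ((x0 + \<i> *\<^sub>c x1 - x2) + (x0 - \<i> *\<^sub>c x1 - x2)) \<le> 2 * norm x"
      by (smt (verit) norm_triangle_ineq)
    moreover have "(x0 + \<i> *\<^sub>c x1 - x2) + (x0 - \<i> *\<^sub>c x1 - x2) = 2 *\<^sub>R (x - 2 *\<^sub>R T x)"
    proof -
      have "T x = T x0 + T x1 + T x2" using x T(1) by metis
      then have "x - 2 *\<^sub>R T x = x0 - x2"
        using x by (simp add: T0 T1 T2 scaleR_2 scaleR_right_distrib)
      then show ?thesis by (simp add: scaleR_2)
    qed
    ultimately have "norm (x - 2 *\<^sub>R T x) \<le> norm x" by simp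
    then have "norm (2 *\<^sub>R T x) \<le> norm x + norm x"
      by (smt (verit) norm_triangle_sub norm_minus_commute)
    then show ?thesis by simp
  qed
  have "(norm e)\<^sup>2 = onorm T" using box_norm[of e] by (simp add: T_def[abs_def])
  also have "\<dots> \<le> 1"
    by (rule onorm_bound) (simp_all add: le)
  finally show ?thesis by (simp add: power_le_one_iff)
qed

section \<open>Almost tripotent elements\<close>

definition defect :: "'a \<Rightarrow> 'a" where
  "defect x = triple x x x - x"

lemma defect_eq_0_iff: "defect x = 0 \<longleftrightarrow> tripotent triple x"
  by (simp add: defect_def tripotent_def)

text \<open>
  The odd function \<open>s \<mapsto> (5 s\<^sup>3 - 3 s\<^sup>5) / 2\<close>.  It fixes \<open>-1\<close>, \<open>0\<close> and \<open>1\<close>, the possible singular values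
  of a tripotent, and its derivative vanishes there; so iterating it moves an almost tripotent
  element quadratically fast to a tripotent.  Newton's iteration \<open>(3 s - s\<^sup>3) / 2\<close> would repel from \<open>0\<close>.
\<close>

definition sharpen :: "'a \<Rightarrow> 'a" where
  "sharpen x = odd_calculus x [:0, 5/2, - 3/2:]"

lemma defect_odd_calculus:
  "defect (odd_calculus x p) = odd_calculus x (pCons 0 (p * p * p) - p)"
  by (simp add: defect_def triple_odd_calculus odd_calculus_diff)

lemma defect_conv_odd_calculus: "defect x = odd_calculus x [:-1, 1:]"
  by (simp add: defect_def)

text \<open>
  Quadratic convergence: with \<open>g(s) = (5 s\<^sup>3 - 3 s\<^sup>5) / 2\<close> and \<open>d(s) = s\<^sup>3 - s\<close>, the polynomial \<open>g\<^sup>3 - g\<close> has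
  zeros of order at least 2 at \<open>-1, 0, 1\<close>.  It equals \<open>d\<^sup>2 s q(s\<^sup>2)\<close> with
  \<open>8 q(u) = (5 - 3 u) (9 u\<^sup>3 - 12 u\<^sup>2 - 8 u - 4)\<close>, whose coefficients appear below.
\<close>

lemma defect_sharpen:
  "defect (sharpen x) = triple (defect x)
     (odd_calculus x [:- 5/2, - 7/2, - 9/2, 81/8, - 27/8:]) (defect x)"
  unfolding sharpen_def defect_odd_calculus
  unfolding defect_conv_odd_calculus triple_odd_calculus
  by (rule arg_cong[where f = "odd_calculus x"]) simp

lemma sharpen_minus_self: "sharpen x - x = defect x - (3/2) *\<^sub>R triple x x (defect x)"
proof -
  have "sharpen x - x = odd_calculus x ([:0, 5/2, - 3/2:] - [:1:])"
    by (simp add: sharpen_def odd_calculus_diff)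
  also have "[:0, 5/2, - 3/2:] - [:1:] = [:-1, 1:] - smult (3/2) (pCons 0 [:-1, 1::real:])"
    by simp
  also have "odd_calculus x \<dots> = defect x - (3/2) *\<^sub>R triple x x (defect x)"
    by (simp only: odd_calculus_diff odd_calculus_smult defect_conv_odd_calculus
        odd_calculus_pCons) simp
  finally show ?thesis .
qed

text \<open>
  Iterate \<open>sharpen\<close>.  While the iterates stay in the ball of radius 2, each defect is bounded by a
  constant times the square of the previous one.  If the first defect is small enough, the defects
  at least halve at each step, the increments are summable, and the limit has defect 0.  The
  increments are at most 7 times the defects, hence the factor \<open>14 = 7 + 7/2 + 7/4 + \<dots>\<close>.
\<close>

lemma tripotent_near_almost_tripotent:
  "\<exists>\<epsilon>>0. \<forall>x. norm x \<le> 3/2 \<and> norm (defect x) \<le> \<epsilon> \<longrightarrow>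
     (\<exists>f. tripotent triple f \<and> norm (f - x) \<le> 14 * norm (defect x))"
proof -
  obtain K where K: "K \<ge> 0"
      "\<And>x. norm x \<le> 2 \<Longrightarrow> norm (odd_calculus x [:- 5/2, - 7/2, - 9/2, 81/8, - 27/8:]) \<le> K"
    using norm_odd_calculus_bounded by blast
  have step: "norm (sharpen y - y) \<le> 7 * norm (defect y)"
    "norm (defect (sharpen y)) \<le> 4 * K * (norm (defect y))\<^sup>2" if "norm y \<le> 2" for y
  proof -
    have "(norm y)\<^sup>2 * norm (defect y) \<le> 2\<^sup>2 * norm (defect y)"
      using that by (intro mult_right_mono power_mono) auto
    then have "norm (triple y y (defect y)) \<le> 4 * norm (defect y)"
      using norm_box_le[of y "defect y"] by simp
    moreover have "norm (sharpen y - y) \<le> norm (defect y) + (3/2) * norm (triple y y (defect y))"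
      unfolding sharpen_minus_self by (rule order_trans[OF norm_triangle_ineq4]) simp
    ultimately show "norm (sharpen y - y) \<le> 7 * norm (defect y)" by simp
    show "norm (defect (sharpen y)) \<le> 4 * K * (norm (defect y))\<^sup>2"
      unfolding defect_sharpen
      using norm_triple_le'[OF order_refl K(2)[OF that] order_refl, of "defect y" "defect y"]
      by (simp add: power2_eq_square mult_ac)
  qed
  define \<epsilon> where "\<epsilon> = 1 / (28 + 8 * K)"
  have \<epsilon>: "\<epsilon> > 0" "14 * \<epsilon> \<le> 1/2" "4 * K * \<epsilon> \<le> 1/2"
    using K(1) by (auto simp: \<epsilon>_def field_simps)
  have "\<exists>f. tripotent triple f \<and> norm (f - x) \<le> 14 * norm (defect x)"
    if x: "norm x \<le> 3/2" "norm (defect x) \<le> \<epsilon>" for x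
  proof -
    define \<rho> where "\<rho> = norm (defect x)"
    define X where "X n = (sharpen ^^ n) x" for n
    have X0: "X 0 = x" and XS: "X (Suc n) = sharpen (X n)" for n by (simp_all add: X_def)
    have \<rho>: "0 \<le> \<rho>" "14 * \<rho> \<le> 1/2" "4 * K * \<rho> \<le> 1/2"
      using x(2) \<epsilon> K(1) mult_left_mono[OF x(2), of "4 * K"] by (auto simp: \<rho>_def)
    have bound: "norm y \<le> 2" if "norm (y - x) \<le> 14 * \<rho> * (1 - 1 / 2 ^ n)" for y and n :: nat
    proof -
      have "14 * \<rho> * (1 - 1 / 2 ^ n) \<le> 14 * \<rho> * 1"
        using \<rho> by (intro mult_left_mono) auto
      then show ?thesis using that \<rho> x(1) norm_triangle_sub[of y x] by linarith
    qed
    have inv: "norm (defect (X n)) \<le> \<rho> / 2 ^ n \<and> norm (X n - x) \<le> 14 * \<rho> * (1 - 1 / 2 ^ n)" for n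
    proof (induction n)
      case 0
      show ?case by (simp add: X0 \<rho>_def)
    next
      case (Suc n)
      then have X2: "norm (X n) \<le> 2" using bound by blast
      have "norm (defect (X (Suc n))) \<le> 4 * K * (norm (defect (X n)))\<^sup>2"
        unfolding XS by (rule step(2)[OF X2])
      also have "\<dots> \<le> 4 * K * (\<rho> / 2 ^ n)\<^sup>2"
        using Suc K by (intro mult_left_mono power_mono) auto
      also have "\<dots> = (4 * K * \<rho>) * (\<rho> / 2 ^ n) * (1 / 2 ^ n)"
        by (simp add: power2_eq_square)
      also have "\<dots> \<le> 1/2 * (\<rho> / 2 ^ n) * 1"
        using \<rho> K by (intro mult_mono) auto
      finally have 1: "norm (defect (X (Suc n))) \<le> \<rho> / 2 ^ Suc n" by simp
      have "norm (X (Suc n) - x) \<le> norm (X (Suc n) - X n) + norm (X n - x)"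
        by (metis add_diff_cancel diff_add_cancel diff_diff_eq2 norm_triangle_ineq)
      also have "\<dots> \<le> 7 * (\<rho> / 2 ^ n) + 14 * \<rho> * (1 - 1 / 2 ^ n)"
        using step(1)[OF X2] Suc unfolding XS by simp
      finally have "norm (X (Suc n) - x) \<le> 14 * \<rho> * (1 - 1 / 2 ^ Suc n)"
        by (simp add: algebra_simps)
      with 1 show ?case by blast
    qed
    have "summable (\<lambda>n. X (Suc n) - X n)"
    proof (rule summable_comparison_test')
      show "summable (\<lambda>n. 7 * \<rho> * (1/2) ^ n)" by (intro summable_mult summable_geometric) simp
      show "norm (X (Suc n) - X n) \<le> 7 * \<rho> * (1/2) ^ n" for n
        using step(1)[of "X n"] bound[of "X n" n] inv[of n] unfolding XS
        by (simp add: power_one_over)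
    qed
    then have "convergent (\<lambda>n. \<Sum>k<n. X (Suc k) - X k)"
      by (simp add: summable_iff_convergent)
    then have "convergent (\<lambda>n. (\<Sum>k<n. X (Suc k) - X k) + x)"
      by (intro convergent_add convergent_const)
    then have "convergent X"
      by (simp add: sum_lessThan_telescope X0)
    then obtain f where f: "X \<longlonglongrightarrow> f" by (auto simp: convergent_def)
    have "(\<lambda>n. \<rho> * (1/2) ^ n) \<longlonglongrightarrow> \<rho> * 0"
      by (intro tendsto_intros LIMSEQ_power_zero) simp
    then have lim0: "(\<lambda>n. \<rho> * (1/2) ^ n) \<longlonglongrightarrow> 0" by simp
    have "norm (defect (X n)) \<le> \<rho> * (1/2) ^ n" for n
      using inv[of n] by (simp add: power_one_over)
    then have "(\<lambda>n. defect (X n)) \<longlonglongrightarrow> 0"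
      by (intro Lim_null_comparison[OF _ lim0] always_eventually allI)
    moreover have "(\<lambda>n. defect (X n)) \<longlonglongrightarrow> defect f"
      unfolding defect_def by (intro tendsto_diff tendsto_triple_diag f)
    ultimately have "tripotent triple f"
      using LIMSEQ_unique defect_eq_0_iff by blast
    moreover have "norm (f - x) \<le> 14 * \<rho>"
    proof (rule tendsto_upperbound)
      show "(\<lambda>n. norm (X n - x)) \<longlonglongrightarrow> norm (f - x)" by (intro tendsto_intros f)
      have "14 * \<rho> * (1 - 1 / 2 ^ n) \<le> 14 * \<rho> * 1" for n :: nat
        using \<rho> by (intro mult_left_mono) auto
      then show "\<forall>\<^sub>F n in sequentially. norm (X n - x) \<le> 14 * \<rho>"
        using inv by (intro always_eventually allI) (smt (verit))
    qed simp
    ultimately show ?thesis by (auto simp: \<rho>_def)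
  qed
  then show ?thesis using \<epsilon>(1) by blast
qed

section \<open>Tripotents near a maximal tripotent\<close>

lemma unitary_imp_maximal:
  assumes "unitary_tripotent triple e"
  shows "maximal_tripotent triple e"
  using assms by (auto simp: unitary_tripotent_def maximal_tripotent_def)

lemma norm_maximal_le_1: "maximal_tripotent triple e \<Longrightarrow> norm e \<le> 1"
  by (simp add: maximal_tripotent_def norm_tripotent_le_1)

text \<open>
  For a maximal tripotent the operator \<open>D\<close> is injective, so the factor \<open>D\<close> in the cubic relation
  \<open>D (2 D\<^sup>2 - 3 D + 1) = 0\<close> can be cancelled.
\<close>

lemma peirce_maximal:
  assumes "maximal_tripotent triple e"
  shows "z = 3 *\<^sub>R triple e e z - 2 *\<^sub>R triple e e (triple e e z)"
proof -
  have "tripotent triple e" and "{z. triple e e z = 0} = {0}"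
    using assms by (simp_all add: maximal_tripotent_def)
  have "triple e e (2 *\<^sub>R triple e e (triple e e z) - 3 *\<^sub>R triple e e z + z) = 0"
    using peirce_box_cubic[OF \<open>tripotent triple e\<close>, of z] by (simp add: triple_simps)
  then have "2 *\<^sub>R triple e e (triple e e z) - 3 *\<^sub>R triple e e z + z = 0"
    using \<open>{z. triple e e z = 0} = {0}\<close> by blast
  then show ?thesis by (simp add: algebra_simps)
qed

text \<open>
  The equation is the derivative at \<open>e\<close>, in direction \<open>v\<close>, of the equation \<open>{x, x, x} = x\<close>: the vector
  field \<open>z \<mapsto> w - {z, w, z}\<close> is tangent to the tripotents at every maximal \<open>e\<close>.  By the Peirce
  relations the left-hand side is \<open>(3 D - 2 D\<^sup>2) w - Q w\<close>, and \<open>3 D - 2 D\<^sup>2 = 1\<close> by maximality.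
\<close>

lemma tangent_maximal:
  fixes w
  assumes "maximal_tripotent triple e"
  defines "v \<equiv> w - triple e w e"
  shows "2 *\<^sub>R triple e e v + triple e v e = v"
proof -
  have e: "tripotent triple e" using assms by (simp add: maximal_tripotent_def)
  have "2 *\<^sub>R triple e e v + triple e v e
    = (3 *\<^sub>R triple e e w - 2 *\<^sub>R triple e e (triple e e w)) - triple e w e"
    by (simp add: v_def triple_simps peirce_box_quad[OF e] peirce_quad_quad[OF e]
        scaleR_3 scaleR_2 algebra_simps)
  also have "\<dots> = v"
    using peirce_maximal[OF assms(1), of w] by (simp add: v_def)
  finally show ?thesis .
qed

text \<open>
  In the expansion of \<open>{e + v, e + v, e + v} - (e + v)\<close> the terms of order 0 cancel because \<open>e\<close> is a
  tripotent and those of order 1 because \<open>v\<close> is tangent; four products of order at least 2 remain.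
\<close>

lemma defect_tangent_le:
  assumes "tripotent triple e" "2 *\<^sub>R triple e e v + triple e v e = v" "norm v \<le> 1"
  shows "norm (defect (e + v)) \<le> 16 * (norm v)\<^sup>2"
proof -
  have e: "triple e e e = e" "norm e \<le> 1"
    using assms(1) norm_tripotent_le_1 by (auto simp: tripotent_def)
  have "defect (e + v) = (2 *\<^sub>R triple e e v + triple e v e - v)
      + (triple e v v + triple v v e + triple v e v + triple v v v)"
    by (simp add: defect_def triple_simps e scaleR_2 triple_commute[of v e e])
  also have "\<dots> = triple e v v + triple v v e + triple v e v + triple v v v"
    by (simp add: assms(2))
  also have "norm \<dots> \<le> 4 * 1 * norm v * norm v + 4 * norm v * norm v * 1
      + 4 * norm v * 1 * norm v + 4 * 1 * norm v * norm v"
    by (intro norm_triangle_mono norm_triple_le') (use assms(3) e(2) in simp_all)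
  also have "\<dots> = 16 * (norm v)\<^sup>2" by (simp add: power2_eq_square)
  finally show ?thesis .
qed

lemma norm_box_diff_le:
  assumes "norm e \<le> 1" "norm f \<le> 1"
  shows "norm (triple e e z - triple f f z) \<le> 8 * norm (f - e) * norm z"
proof -
  have "triple e e z - triple f f z = triple (e - f) e z + triple f (e - f) z"
    by (simp add: triple_simps)
  also have "norm \<dots> \<le> 4 * norm (e - f) * 1 * norm z + 4 * 1 * norm (e - f) * norm z"
    using assms by (intro norm_triangle_mono norm_triple_le') auto
  finally show ?thesis by (simp add: norm_minus_commute mult_ac)
qed

text \<open>
  From \<open>z = 3 D z - 2 D\<^sup>2 z\<close> and \<open>\<parallel>D\<parallel> \<le> 1\<close> one gets \<open>\<parallel>z\<parallel> \<le> 5 \<parallel>D z\<parallel>\<close>.  Such a lower bound survives a small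
  perturbation of \<open>D\<close>, so the operator of a nearby tripotent is injective as well;
  the distance \<open>1/40\<close> compensates the factor 5 and the factor 8 of \<open>norm_box_diff_le\<close>.
\<close>

lemma maximal_near_maximal:
  assumes "maximal_tripotent triple e" "tripotent triple f" "norm (f - e) < 1/40"
  shows "maximal_tripotent triple f"
proof -
  have ef: "norm e \<le> 1" "norm f \<le> 1"
    using assms norm_maximal_le_1 norm_tripotent_le_1 by auto
  have "z = 0" if "triple f f z = 0" for z
  proof (rule ccontr)
    assume "z \<noteq> 0"
    have contr: "norm (triple e e y) \<le> norm y" for y
      using norm_box_le[of e y] mult_right_mono[of "(norm e)\<^sup>2" 1 "norm y"] power_le_one[OF norm_ge_zero ef(1)]
      by fastforce
    have "norm z \<le> 3 * norm (triple e e z) + 2 * norm (triple e e (triple e e z))"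
      by (subst peirce_maximal[OF assms(1), of z]) (rule order_trans[OF norm_triangle_ineq4], simp)
    also have "\<dots> \<le> 5 * norm (triple e e z)"
      using contr[of "triple e e z"] by simp
    also have "\<dots> \<le> 40 * norm (f - e) * norm z"
      using norm_box_diff_le[OF ef, of z] that by (simp add: mult_ac)
    also have "\<dots> < 1 * norm z"
      using assms(3) \<open>z \<noteq> 0\<close> by (intro mult_strict_right_mono) auto
    finally show False by simp
  qed
  then show ?thesis using assms(2) by (auto simp: maximal_tripotent_def)
qed

text \<open>
  The operator of the maximal tripotent \<open>f\<close> has only the eigenvalues 1/2 and 1.  An eigenvector for
  1/2 is impossible, because the operator is close to that of \<open>e\<close>, which is the identity.
\<close>

lemma unitary_near_unitary:
  assumes "unitary_tripotent triple e" "maximal_tripotent triple f" "norm (f - e) < 1/40"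
  shows "unitary_tripotent triple f"
proof -
  have ef: "norm e \<le> 1" "norm f \<le> 1"
    using assms norm_maximal_le_1 unitary_imp_maximal by auto
  have "triple f f z = z" for z
  proof (rule ccontr)
    assume "triple f f z \<noteq> z"
    define y where "y = triple f f z - z"
    have "y \<noteq> 0" using \<open>triple f f z \<noteq> z\<close> by (simp add: y_def)
    have "2 *\<^sub>R triple f f y = y"
      using peirce_maximal[OF assms(2), of z]
      by (simp add: y_def triple_simps scaleR_2 scaleR_3 algebra_simps)
    then have "2 *\<^sub>R (triple e e y - triple f f y) = y"
      using assms(1) by (simp add: unitary_tripotent_def scaleR_right_diff_distrib scaleR_2)
    then have "norm y = 2 * norm (triple e e y - triple f f y)"
      by (metis norm_scaleR abs_numeral)
    also have "\<dots> \<le> 16 * norm (f - e) * norm y"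
      using norm_box_diff_le[OF ef, of y] by (simp add: mult_ac)
    also have "\<dots> < 1 * norm y"
      using assms(3) \<open>y \<noteq> 0\<close> by (intro mult_strict_right_mono) auto
    finally show False by simp
  qed
  then show ?thesis
    using assms(2) by (simp add: unitary_tripotent_def maximal_tripotent_def)
qed

text \<open>
  A quantitative way to say that \<open>\<Gamma>\<close> is invariant under the flows of the vector fields
  \<open>z \<mapsto> w - {z, w, z}\<close>: one Euler step misses \<open>\<Gamma>\<close> by a second-order error only, uniformly on \<open>\<Gamma>\<close>.
\<close>

definition tangentially_complete :: "'a set \<Rightarrow> bool" where
  "tangentially_complete \<Gamma> \<longleftrightarrow> (\<exists>\<epsilon>>0. \<exists>C\<ge>0. \<forall>e\<in>\<Gamma>. \<forall>w. norm w \<le> \<epsilon> \<longrightarrow>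
     (\<exists>f\<in>\<Gamma>. norm (f - (e + w - triple e w e)) \<le> C * (norm w)\<^sup>2))"

text \<open>
  The element \<open>e + v\<close> with \<open>v = w - {e, w, e}\<close> solves the tripotent equation up to second order in
  \<open>w\<close>; sharpening it gives the tripotent \<open>f\<close>.  The distance \<open>1/40\<close> is the one
  that makes \<open>f\<close> maximal, and unitary if \<open>e\<close> is.
\<close>

lemma maximal_near_tangent:
  "\<exists>\<epsilon>>0. \<exists>C\<ge>0. \<forall>e w. maximal_tripotent triple e \<and> norm w \<le> \<epsilon> \<longrightarrow>
     (\<exists>f. maximal_tripotent triple f \<and> norm (f - e) < 1/40 \<and>
        norm (f - (e + w - triple e w e)) \<le> C * (norm w)\<^sup>2)"
proof -
  obtain \<epsilon> where "\<epsilon> > 0" and near: "\<And>x. norm x \<le> 3/2 \<Longrightarrow> norm (defect x) \<le> \<epsilon> \<Longrightarrow>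
     \<exists>f. tripotent triple f \<and> norm (f - x) \<le> 14 * norm (defect x)"
    using tripotent_near_almost_tripotent by blast
  define \<delta> where "\<delta> = min (\<epsilon> / 400) (1 / 1000000)"
  have \<delta>: "\<delta> > 0" "400 * \<delta> \<le> \<epsilon>" "\<delta> \<le> 1 / 1000000" using \<open>\<epsilon> > 0\<close> by (auto simp: \<delta>_def)
  \<comment> \<open>Here \<open>\<parallel>v\<parallel> \<le> 5 \<parallel>w\<parallel>\<close>, so the defect of \<open>e + v\<close> is at most \<open>16 \<cdot> 5\<^sup>2 \<parallel>w\<parallel>\<^sup>2 = 400 \<parallel>w\<parallel>\<^sup>2\<close>, and
    sharpening moves \<open>e + v\<close> by at most \<open>14 \<cdot> 400 \<parallel>w\<parallel>\<^sup>2\<close>.\<close>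
  have "\<exists>f. maximal_tripotent triple f \<and> norm (f - e) < 1/40 \<and>
        norm (f - (e + w - triple e w e)) \<le> 5600 * (norm w)\<^sup>2"
    if e: "maximal_tripotent triple e" and w: "norm w \<le> \<delta>" for e w
  proof -
    have e': "tripotent triple e" "norm e \<le> 1"
      using e norm_maximal_le_1 by (auto simp: maximal_tripotent_def)
    define v where "v = w - triple e w e"
    have "norm v \<le> norm w + 4 * 1 * norm w * 1"
      unfolding v_def
      by (intro order_trans[OF norm_triangle_ineq4] add_mono norm_triple_le') (simp_all add: e')
    then have v: "norm v \<le> 5 * norm w" by simp
    have w2: "(norm w)\<^sup>2 \<le> norm w"
      using w \<delta> mult_right_mono[of "norm w" 1 "norm w"] by (simp add: power2_eq_square)
    have "(norm v)\<^sup>2 \<le> (5 * norm w)\<^sup>2" using v by (intro power_mono) auto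
    moreover have "norm (defect (e + v)) \<le> 16 * (norm v)\<^sup>2"
      using v w \<delta> unfolding v_def by (intro defect_tangent_le e' tangent_maximal e) auto
    ultimately have d: "norm (defect (e + v)) \<le> 400 * (norm w)\<^sup>2"
      by (simp add: power_mult_distrib)
    have "norm (e + v) \<le> 3/2" using norm_triangle_ineq[of e v] e' v w \<delta> by linarith
    moreover have "norm (defect (e + v)) \<le> \<epsilon>" using d w2 w \<delta> by linarith
    ultimately obtain f where f: "tripotent triple f" "norm (f - (e + v)) \<le> 14 * norm (defect (e + v))"
      using near by blast
    have "norm (f - e) \<le> norm (f - (e + v)) + norm v"
      using norm_triangle_ineq[of "f - (e + v)" v] by simp
    then have "norm (f - e) < 1/40" using f(2) d w2 v w \<delta> by linarith
    moreover have "norm (f - (e + w - triple e w e)) \<le> 5600 * (norm w)\<^sup>2"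
      using f(2) d by (simp add: v_def algebra_simps)
    ultimately show ?thesis using maximal_near_maximal[OF e f(1)] by blast
  qed
  then show ?thesis using \<delta>(1) by (intro exI[of _ \<delta>] conjI exI[of _ 5600]) auto
qed

lemma tangentially_complete_maximal: "tangentially_complete {e. maximal_tripotent triple e}"
  using maximal_near_tangent unfolding tangentially_complete_def by fast

lemma tangentially_complete_unitary: "tangentially_complete {e. unitary_tripotent triple e}"
proof -
  obtain \<epsilon> C where "\<epsilon> > 0" "C \<ge> 0" and *: "\<And>e w. maximal_tripotent triple e \<and> norm w \<le> \<epsilon> \<Longrightarrow>
     (\<exists>f. maximal_tripotent triple f \<and> norm (f - e) < 1/40 \<and>
        norm (f - (e + w - triple e w e)) \<le> C * (norm w)\<^sup>2)"
    using maximal_near_tangent by blast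
  have "\<exists>f\<in>{e. unitary_tripotent triple e}. norm (f - (e + w - triple e w e)) \<le> C * (norm w)\<^sup>2"
    if "unitary_tripotent triple e" "norm w \<le> \<epsilon>" for e w
    using *[of e w] that unitary_imp_maximal unitary_near_unitary by blast
  then show ?thesis
    unfolding tangentially_complete_def using \<open>\<epsilon> > 0\<close> \<open>C \<ge> 0\<close> by blast
qed

section \<open>Euler steps along the segment to a point of the ball\<close>

text \<open>
  The field that carries \<open>t b\<close> to the next point of the segment.  The equation
  \<open>a - {t b, a, t b} = b\<close> is solved by \<open>a = b / (1 - t\<^sup>2 b\<^sup>2)\<close>, read as the geometric series of odd powers
  of \<open>b\<close> with coefficients \<open>(t\<^sup>2)^k\<close>: by power associativity \<open>z \<mapsto> {t b, z, t b}\<close> shifts this series by one term.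
\<close>

lemma radial_vector_field:
  assumes "norm b < 1" "0 \<le> t" "t \<le> 1"
  shows "\<exists>a. norm a \<le> norm b / (1 - (norm b)\<^sup>2) \<and> a - triple (t *\<^sub>R b) a (t *\<^sub>R b) = b"
proof -
  define f where "f k = (t\<^sup>2) ^ k *\<^sub>R opow b k" for k
  have b2: "(norm b)\<^sup>2 < 1" using assms(1) by (simp add: power_less_one_iff abs_square_less_1)
  have f_le: "norm (f k) \<le> norm b * ((norm b)\<^sup>2) ^ k" for k
  proof -
    have "norm (f k) \<le> 1 * norm b ^ (2 * k + 1)"
      unfolding f_def norm_scaleR using assms
      by (intro mult_mono norm_opow_le) (auto simp: power_le_one)
    then show ?thesis by (simp add: power_mult)
  qed
  have geo: "summable (\<lambda>k. norm b * ((norm b)\<^sup>2) ^ k)"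
    using b2 by (intro summable_mult summable_geometric) simp
  have f: "summable f" by (rule summable_comparison_test'[OF geo]) (rule f_le)
  have "norm (suminf f) \<le> (\<Sum>k. norm b * ((norm b)\<^sup>2) ^ k)"
    by (rule norm_suminf_le[OF f_le geo])
  also have "\<dots> = norm b / (1 - (norm b)\<^sup>2)"
    using b2 by (subst suminf_mult) (simp_all add: suminf_geometric summable_geometric)
  finally have le: "norm (suminf f) \<le> norm b / (1 - (norm b)\<^sup>2)" .
  have step: "triple (t *\<^sub>R b) (f k) (t *\<^sub>R b) = f (Suc k)" for k
    using triple_opow[of b 0 k 0] by (simp add: f_def triple_simps power2_eq_square mult_ac)
  have "triple (t *\<^sub>R b) (suminf f) (t *\<^sub>R b) = (\<Sum>k. f (Suc k))"
    using bounded_linear.suminf[OF bounded_linear_triple_mid f, of "t *\<^sub>R b" "t *\<^sub>R b"] by (simp add: step)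
  also have "\<dots> = suminf f - b"
    using suminf_split_head[OF f] by (simp add: f_def)
  finally show ?thesis using le by (intro exI[of _ "suminf f"]) simp
qed

primrec euler :: "(nat \<Rightarrow> 'a) \<Rightarrow> nat \<Rightarrow> 'a \<Rightarrow> 'a" where
  "euler w 0 z = z"
| "euler w (Suc k) z = euler w k z + w k - triple (euler w k z) (w k) (euler w k z)"

section \<open>Polynomial curves and their means\<close>

text \<open>
  Polynomials in one complex variable with coefficients in the triple, generated from monomials by
  addition so that closure under the triple product follows by bilinear induction.
\<close>

inductive polynomial_curve :: "(complex \<Rightarrow> 'a) \<Rightarrow> bool" where
  monomial: "polynomial_curve (\<lambda>c. c ^ n *\<^sub>c u)"
| add: "polynomial_curve f \<Longrightarrow> polynomial_curve g \<Longrightarrow> polynomial_curve (\<lambda>c. f c + g c)"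

lemma polynomial_curve_const: "polynomial_curve (\<lambda>c. u)"
  using polynomial_curve.monomial[of 0 u] by simp

lemma polynomial_curve_uminus:
  assumes "polynomial_curve f"
  shows "polynomial_curve (\<lambda>c. - f c)"
  using assms
proof induction
  case (monomial n u)
  then show ?case using polynomial_curve.monomial[of n "- u"] by simp
next
  case (add f g)
  then show ?case using polynomial_curve.add[OF add.IH] by simp
qed

lemma polynomial_curve_triple:
  assumes "polynomial_curve f" "polynomial_curve g"
  shows "polynomial_curve (\<lambda>c. triple (f c) a (g c))"
  using assms(1)
proof induction
  case (monomial n u)
  show ?case using assms(2)
  proof induction
    case (monomial m v)
    then show ?case using polynomial_curve.monomial[of "m + n" "triple u a v"]
      by (simp add: triple_scaleC_left triple_scaleC_right power_add)
  next
    case (add f g)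
    then show ?case using polynomial_curve.add[OF add.IH] by (simp add: triple_simps)
  qed
next
  case (add f g)
  then show ?case using polynomial_curve.add[OF add.IH] by (simp add: triple_simps)
qed

lemma polynomial_curve_euler: "polynomial_curve (\<lambda>c. euler w k (c *\<^sub>c e))"
proof (induction k)
  case 0
  then show ?case using polynomial_curve.monomial[of 1 e] by simp
next
  case (Suc k)
  then show ?case
    by (auto simp: diff_conv_add_uminus simp del: add_uminus_conv_diff
        intro!: polynomial_curve.add polynomial_curve_const polynomial_curve_uminus
          polynomial_curve_triple)
qed

lemma sum_cis_powers:
  assumes "0 < n" "n < N"
  shows "(\<Sum>j<N. cis (2 * pi * real j / real N) ^ n) = 0"
proof -
  define z where "z = cis (2 * pi * real n / real N)"
  have "cis (2 * pi * real j / real N) ^ n = z ^ j" for j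
    unfolding z_def Complex.DeMoivre by (rule arg_cong[where f = cis]) simp
  moreover have "z \<noteq> 1"
  proof
    assume "z = 1"
    have "inj_on (\<lambda>k. cis (2 * pi * real k / real N)) {..<N}"
      using Complex.bij_betw_roots_unity[of N] assms by (simp add: bij_betw_def)
    moreover have "cis (2 * pi * real n / real N) = cis (2 * pi * real 0 / real N)"
      using \<open>z = 1\<close> by (simp add: z_def)
    ultimately have "n = 0" by (rule inj_onD) (use assms in auto)
    then show False using assms(1) by simp
  qed
  moreover have "z ^ N = 1"
  proof -
    have "z ^ N = cis (2 * pi * real n)"
      unfolding z_def Complex.DeMoivre using assms by (intro arg_cong[where f = cis]) simp
    then show ?thesis by (simp add: cis_multiple_2pi)
  qed
  ultimately show ?thesis by (simp add: geometric_sum)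
qed

text \<open>
  The mean value property in finite form: over the \<open>N\<close>-th roots of unity every monomial of degree
  between 1 and \<open>N - 1\<close> averages to 0, so only the constant term survives once \<open>N\<close> exceeds the degree.
\<close>

lemma polynomial_curve_mean:
  assumes "polynomial_curve f"
  shows "\<exists>M. \<forall>N>M. (\<Sum>j<N. f (cis (2 * pi * real j / real N))) = real N *\<^sub>R f 0"
  using assms
proof induction
  case (monomial n u)
  have "(\<Sum>j<N. cis (2 * pi * real j / real N) ^ n *\<^sub>c u) = real N *\<^sub>R (0 ^ n *\<^sub>c u)" if "N > n" for N
  proof (cases "n = 0")
    case True
    then show ?thesis by (simp add: sum_constant_scaleR)
  next
    case False
    then show ?thesis
      using that sum_cis_powers[of n N] by (simp flip: scale_sum_left)
  qed
  then show ?case by blast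
next
  case (add f g)
  then obtain M M' where
    "\<forall>N>M. (\<Sum>j<N. f (cis (2 * pi * real j / real N))) = real N *\<^sub>R f 0"
    "\<forall>N>M'. (\<Sum>j<N. g (cis (2 * pi * real j / real N))) = real N *\<^sub>R g 0" by blast
  then show ?case
    by (intro exI[of _ "max M M'"]) (simp add: sum.distrib scaleR_add_right)
qed

section \<open>Convex hulls of tangentially complete sets\<close>

lemma convex_hull_near_mean:
  fixes F :: "nat \<Rightarrow> 'a"
  assumes "N > 0" and "\<And>j. j < N \<Longrightarrow> \<exists>f\<in>S. norm (F j - f) \<le> \<eta>"
  shows "\<exists>y\<in>convex hull S. norm ((\<Sum>j<N. F j) /\<^sub>R real N - y) \<le> \<eta>"
proof -
  obtain f where f: "\<And>j. j < N \<Longrightarrow> f j \<in> S" "\<And>j. j < N \<Longrightarrow> norm (F j - f j) \<le> \<eta>"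
    using assms(2) by metis
  define y where "y = (\<Sum>j<N. (1 / real N) *\<^sub>R f j)"
  have "y \<in> convex hull S" unfolding y_def
    using assms(1) f(1) by (intro convex_sum) (auto intro: hull_inc)
  moreover have "norm ((\<Sum>j<N. F j) /\<^sub>R real N - y) \<le> \<eta>"
  proof -
    have "(\<Sum>j<N. F j) /\<^sub>R real N - y = (\<Sum>j<N. F j - f j) /\<^sub>R real N"
      by (simp add: y_def sum_subtractf scaleR_diff_right scaleR_sum_right divide_inverse)
    also have "norm \<dots> = norm (\<Sum>j<N. F j - f j) / real N"
      by (simp add: divide_inverse mult.commute)
    also have "\<dots> \<le> (\<Sum>j<N. \<eta>) / real N"
      using f(2) by (intro divide_right_mono sum_norm_le) auto
    also have "\<dots> = \<eta>" using assms(1) by simp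
    finally show ?thesis .
  qed
  ultimately show ?thesis by blast
qed

lemma quadratic_step_lipschitz:
  assumes "norm e \<le> 1" "norm (x - e) \<le> 1"
  shows "norm (triple x w x - triple e w e) \<le> 12 * norm w * norm (x - e)"
proof -
  have "norm (x + e) \<le> norm (x - e) + norm (2 *\<^sub>R e)"
    using norm_triangle_ineq[of "x - e" "2 *\<^sub>R e"] by (simp add: scaleR_2)
  then have "norm (x + e) \<le> norm (x - e) + 2 * norm e" by simp
  then have "norm (x + e) \<le> 3" using assms by linarith
  (* The mixed terms of this product cancel since the product is symmetric in its outer variables. *)
  have "triple x w x - triple e w e = triple (x - e) w (x + e)"
    by (simp add: triple_simps triple_commute[of x w e])
  then show ?thesis
    using norm_triple_le'[OF order_refl order_refl \<open>norm (x + e) \<le> 3\<close>, of "x - e" w]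
    by (simp add: mult_ac)
qed

text \<open>
  The usual error analysis of Euler's method: a step adds an error of at most \<open>C \<delta>\<^sup>2\<close> and expands the
  accumulated one by at most \<open>1 + 12 \<delta>\<close>.  The assumption \<open>small\<close> keeps the polygon within distance 1
  of \<open>\<Gamma>\<close>, where this Lipschitz constant is valid.
\<close>

lemma euler_near:
  assumes \<Gamma>: "\<And>e. e \<in> \<Gamma> \<Longrightarrow> norm e \<le> 1"
    and tang: "\<And>e w. e \<in> \<Gamma> \<Longrightarrow> norm w \<le> \<epsilon> \<Longrightarrow>
      \<exists>f\<in>\<Gamma>. norm (f - (e + w - triple e w e)) \<le> C * (norm w)\<^sup>2"
    and "C \<ge> 0" and w: "\<And>k. k < n \<Longrightarrow> norm (w k) \<le> \<delta>" and "\<delta> \<le> \<epsilon>" "\<delta> \<ge> 0"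
    and small: "C * \<delta>\<^sup>2 * real n * (1 + 12 * \<delta>) ^ n \<le> 1"
    and "e \<in> \<Gamma>" "k \<le> n"
  shows "\<exists>f\<in>\<Gamma>. norm (euler w k e - f) \<le> C * \<delta>\<^sup>2 * real k * (1 + 12 * \<delta>) ^ k"
  using \<open>k \<le> n\<close>
proof (induction k)
  case 0
  then show ?case using \<open>e \<in> \<Gamma>\<close> by (intro bexI[of _ e]) auto
next
  case (Suc k)
  define q where "q = 1 + 12 * \<delta>"
  have q: "q \<ge> 1" using \<open>\<delta> \<ge> 0\<close> by (simp add: q_def)
  obtain f where f: "f \<in> \<Gamma>" "norm (euler w k e - f) \<le> C * \<delta>\<^sup>2 * real k * q ^ k"
    using Suc by (auto simp: q_def)
  define x where "x = euler w k e"
  have wk: "norm (w k) \<le> \<delta>" using w Suc.prems by simp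
  obtain g where g: "g \<in> \<Gamma>" "norm (g - (f + w k - triple f (w k) f)) \<le> C * (norm (w k))\<^sup>2"
    using tang[OF f(1), of "w k"] wk \<open>\<delta> \<le> \<epsilon>\<close> by auto
  have "C * \<delta>\<^sup>2 * real k * q ^ k \<le> C * \<delta>\<^sup>2 * real n * q ^ n"
    using Suc.prems q \<open>C \<ge> 0\<close>
    by (intro mult_mono mult_left_mono power_increasing mult_nonneg_nonneg) auto
  then have x1: "norm (x - f) \<le> 1" using f(2) small by (simp add: x_def q_def)
  have "norm (triple x (w k) x - triple f (w k) f) \<le> 12 * norm (w k) * norm (x - f)"
    by (rule quadratic_step_lipschitz[OF \<Gamma>[OF f(1)] x1])
  also have "\<dots> \<le> 12 * \<delta> * norm (x - f)"
    using wk by (intro mult_right_mono) auto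
  finally have lip: "norm (triple x (w k) x - triple f (w k) f) \<le> 12 * \<delta> * norm (x - f)" .
  have "C * (norm (w k))\<^sup>2 \<le> C * \<delta>\<^sup>2"
    using wk \<open>C \<ge> 0\<close> by (intro mult_left_mono power_mono) auto
  with g(2) have g2: "norm (g - (f + w k - triple f (w k) f)) \<le> C * \<delta>\<^sup>2" by linarith
  have "euler w (Suc k) e - g = (x - f) - (triple x (w k) x - triple f (w k) f)
      - (g - (f + w k - triple f (w k) f))"
    by (simp add: x_def)
  then have "norm (euler w (Suc k) e - g) \<le> norm (x - f) + norm (triple x (w k) x - triple f (w k) f)
      + norm (g - (f + w k - triple f (w k) f))"
    by (simp only:) (rule order_trans[OF norm_triangle_ineq4 add_right_mono[OF norm_triangle_ineq4]])
  also have "\<dots> \<le> q * norm (x - f) + C * \<delta>\<^sup>2"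
    using lip g2 by (simp add: q_def distrib_right)
  also have "\<dots> \<le> q * (C * \<delta>\<^sup>2 * real k * q ^ k) + C * \<delta>\<^sup>2 * q ^ Suc k"
    using f(2) q \<open>C \<ge> 0\<close> one_le_power[of q "Suc k"] mult_left_mono[of 1 "q ^ Suc k" "C * \<delta>\<^sup>2"]
    by (intro add_mono mult_left_mono) (auto simp: x_def)
  also have "\<dots> = C * \<delta>\<^sup>2 * real (Suc k) * q ^ Suc k"
    by (simp add: algebra_simps)
  finally show ?case using g(1) unfolding q_def by blast
qed

text \<open>
  Divide the segment from 0 to \<open>b\<close> into \<open>n\<close> parts.  The composite of the Euler steps sends 0 to \<open>b\<close>, so
  \<open>b\<close> is the average of its values at \<open>c e\<close> for roots of unity \<open>c\<close>.  The points \<open>c e\<close> lie in \<open>\<Gamma>\<close>, their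
  images within \<open>B / n\<close> of \<open>\<Gamma>\<close>; hence \<open>b\<close> is within \<open>B / n\<close> of the convex hull.
\<close>

lemma ball_subset_closed_convex_hull:
  assumes "e \<in> \<Gamma>"
    and le1: "\<And>e. e \<in> \<Gamma> \<Longrightarrow> norm e \<le> 1"
    and circ: "\<And>e c. e \<in> \<Gamma> \<Longrightarrow> cmod c = 1 \<Longrightarrow> c *\<^sub>c e \<in> \<Gamma>"
    and "tangentially_complete \<Gamma>"
  shows "ball 0 1 \<subseteq> closure (convex hull \<Gamma>)"
proof
  fix b :: 'a assume "b \<in> ball 0 1"
  then have b: "norm b < 1" by simp
  obtain \<epsilon> C where "\<epsilon> > 0" "C \<ge> 0" and tang: "\<And>e w. e \<in> \<Gamma> \<Longrightarrow> norm w \<le> \<epsilon> \<Longrightarrow>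
      \<exists>f\<in>\<Gamma>. norm (f - (e + w - triple e w e)) \<le> C * (norm w)\<^sup>2"
    using assms(4) unfolding tangentially_complete_def by blast
  define A where "A = norm b / (1 - (norm b)\<^sup>2)"
  have "A \<ge> 0" using b by (simp add: A_def abs_square_le_1)
  \<comment> \<open>Here \<open>A\<close> bounds the vector fields along the segment, and \<open>exp (12 A)\<close> bounds the total expansion
    \<open>(1 + 12 A / n)^n\<close> of \<open>n\<close> steps.\<close>
  define B where "B = C * A\<^sup>2 * exp (12 * A)"
  have "B \<ge> 0" using \<open>C \<ge> 0\<close> by (simp add: B_def)
  have approx: "\<exists>y\<in>convex hull \<Gamma>. norm (b - y) \<le> B / real n"
    if n: "n > 0" "A / real n \<le> \<epsilon>" "B / real n \<le> 1" for n
  proof -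
    define \<delta> where "\<delta> = A / real n"
    have \<delta>: "0 \<le> \<delta>" "\<delta> \<le> \<epsilon>" using n \<open>A \<ge> 0\<close> by (auto simp: \<delta>_def)
    have "\<exists>a. norm a \<le> A \<and> a - triple ((real k / real n) *\<^sub>R b) a ((real k / real n) *\<^sub>R b) = b"
      if "k < n" for k
      unfolding A_def using that by (intro radial_vector_field[OF b]) auto
    then obtain a where a: "\<And>k. k < n \<Longrightarrow> norm (a k) \<le> A"
      "\<And>k. k < n \<Longrightarrow> a k - triple ((real k / real n) *\<^sub>R b) (a k) ((real k / real n) *\<^sub>R b) = b"
      by metis
    define w where "w k = (1 / real n) *\<^sub>R a k" for k
    have w: "norm (w k) \<le> \<delta>" if "k < n" for k
      using a(1)[OF that] n by (simp add: w_def \<delta>_def divide_right_mono)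
    have centre: "euler w k 0 = (real k / real n) *\<^sub>R b" if "k \<le> n" for k
      using that
    proof (induction k)
      case (Suc k)
      have "w k - triple ((real k / real n) *\<^sub>R b) (w k) ((real k / real n) *\<^sub>R b) = (1 / real n) *\<^sub>R b"
        using arg_cong[OF a(2)[of k], of "\<lambda>u. (1 / real n) *\<^sub>R u"] Suc.prems
        by (simp only: w_def triple_scaleR_mid scaleR_diff_right)
      then have "euler w (Suc k) 0 = (real k / real n) *\<^sub>R b + (1 / real n) *\<^sub>R b"
        using Suc by (simp add: algebra_simps)
      then show ?case by (simp add: add_divide_distrib add.commute flip: scaleR_add_left)
    qed simp
    have bound: "C * \<delta>\<^sup>2 * real n * (1 + 12 * \<delta>) ^ n \<le> B / real n"
    proof -
      have "(1 + 12 * \<delta>) ^ n \<le> exp (12 * \<delta>) ^ n"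
        using \<delta> by (intro power_mono exp_ge_add_one_self) auto
      also have "\<dots> = exp (12 * A)"
        using n by (simp add: \<delta>_def flip: exp_of_nat_mult)
      finally have "C * \<delta>\<^sup>2 * real n * (1 + 12 * \<delta>) ^ n \<le> C * \<delta>\<^sup>2 * real n * exp (12 * A)"
        using \<open>C \<ge> 0\<close> by (intro mult_left_mono) auto
      also have "\<dots> = B / real n"
        using n by (simp add: \<delta>_def B_def power2_eq_square)
      finally show ?thesis .
    qed
    have near: "\<exists>f\<in>\<Gamma>. norm (euler w n g - f) \<le> B / real n" if "g \<in> \<Gamma>" for g
    proof -
      have "C * \<delta>\<^sup>2 * real n * (1 + 12 * \<delta>) ^ n \<le> 1"
        using bound n(3) by (rule order_trans)
      from euler_near[of \<Gamma> \<epsilon> C n w, OF le1 tang \<open>C \<ge> 0\<close> w \<delta>(2) \<delta>(1) this that order_refl]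
      obtain f where "f \<in> \<Gamma>"
        "norm (euler w n g - f) \<le> C * \<delta>\<^sup>2 * real n * (1 + 12 * \<delta>) ^ n" by auto
      with bound show ?thesis by (intro bexI[of _ f]) auto
    qed
    obtain M where M: "\<And>N. N > M \<Longrightarrow>
      (\<Sum>j<N. euler w n (cis (2 * pi * real j / real N) *\<^sub>c e)) = real N *\<^sub>R euler w n (0 *\<^sub>c e)"
      using polynomial_curve_mean[OF polynomial_curve_euler[of w n e]] by blast
    define N where "N = Suc M"
    have "\<exists>y\<in>convex hull \<Gamma>.
      norm ((\<Sum>j<N. euler w n (cis (2 * pi * real j / real N) *\<^sub>c e)) /\<^sub>R real N - y) \<le> B / real n"
      by (rule convex_hull_near_mean) (simp add: N_def, intro near circ \<open>e \<in> \<Gamma>\<close> norm_cis)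
    moreover have "(\<Sum>j<N. euler w n (cis (2 * pi * real j / real N) *\<^sub>c e)) /\<^sub>R real N = b"
      using M[of N] centre[of n] n by (simp add: N_def del: of_nat_Suc)
    ultimately show ?thesis by simp
  qed
  show "b \<in> closure (convex hull \<Gamma>)"
    unfolding closure_approachable
  proof (intro allI impI)
    fix r :: real assume "r > 0"
    have lim: "(\<lambda>n. c / real n) \<longlonglongrightarrow> 0" for c by (rule lim_const_over_n)
    have "\<forall>\<^sub>F n in sequentially. n > 0 \<and> A / real n < \<epsilon> \<and> B / real n < 1 \<and> B / real n < r"
      using \<open>\<epsilon> > 0\<close> \<open>r > 0\<close>
      by (intro eventually_conj eventually_gt_at_top order_tendstoD(2)[OF lim]) auto
    then obtain n where "n > 0" "A / real n < \<epsilon>" "B / real n < 1" "B / real n < r"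
      using eventually_happens'[OF sequentially_bot] by blast
    then obtain y where "y \<in> convex hull \<Gamma>" "norm (b - y) \<le> B / real n"
      using approx[of n] by auto
    with \<open>B / real n < r\<close> show "\<exists>y\<in>convex hull \<Gamma>. dist y b < r"
      by (intro bexI[of _ y]) (simp_all add: dist_norm norm_minus_commute)
  qed
qed

lemma closed_ball_eq_closed_convex_hull:
  assumes "e \<in> \<Gamma>"
    and "\<And>e. e \<in> \<Gamma> \<Longrightarrow> norm e \<le> 1"
    and "\<And>e c. e \<in> \<Gamma> \<Longrightarrow> cmod c = 1 \<Longrightarrow> c *\<^sub>c e \<in> \<Gamma>"
    and "tangentially_complete \<Gamma>"
  shows "closure (ball 0 1) = closure (convex hull \<Gamma>)"
proof
  show "closure (ball 0 1) \<subseteq> closure (convex hull \<Gamma>)"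
    using ball_subset_closed_convex_hull[OF assms] by (rule closure_minimal[OF _ closed_closure])
  have "convex hull \<Gamma> \<subseteq> cball 0 1"
    using assms(2) by (intro hull_minimal) (auto simp: convex_cball)
  then show "closure (convex hull \<Gamma>) \<subseteq> closure (ball 0 1)"
    by (simp add: closure_minimal)
qed

lemma triple_unimodular:
  assumes "cmod c = 1"
  shows "triple (c *\<^sub>c e) (c *\<^sub>c e) z = triple e e z"
proof -
  have "c * cnj c = 1" using complex_norm_square[of c] assms by simp
  then have "cnj c * c = 1" by (simp add: mult.commute)
  with \<open>c * cnj c = 1\<close> show ?thesis
    by (simp add: triple_scaleC_left triple_scaleC_mid)
qed

lemma maximal_unimodular:
  assumes "maximal_tripotent triple e" "cmod c = 1"
  shows "maximal_tripotent triple (c *\<^sub>c e)"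
  using assms
  by (simp add: maximal_tripotent_def tripotent_def triple_unimodular triple_scaleC_right)

lemma unitary_unimodular:
  assumes "unitary_tripotent triple e" "cmod c = 1"
  shows "unitary_tripotent triple (c *\<^sub>c e)"
  using assms
  by (simp add: unitary_tripotent_def tripotent_def triple_unimodular triple_scaleC_right)

end

theorem theorem3p1:
  fixes scaleC :: "complex \<Rightarrow> 'a::banach \<Rightarrow> 'a"
    and triple :: "'a \<Rightarrow> 'a \<Rightarrow> 'a \<Rightarrow> 'a"
  assumes "jb_triple scaleC triple"
  shows "((\<exists>e. maximal_tripotent triple e) \<longrightarrow>
            closure (ball 0 1) = closure (convex hull {e. maximal_tripotent triple e})) \<and>
         ((\<exists>e. unitary_tripotent triple e) \<longrightarrow>
            closure (ball 0 1) = closure (convex hull {e. unitary_tripotent triple e}))"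
proof -
  interpret jb_triple scaleC triple by fact
  show ?thesis
  proof (intro conjI impI; elim exE)
    fix e assume "maximal_tripotent triple e"
    then show "closure (ball 0 1) = closure (convex hull {e. maximal_tripotent triple e})"
      by (intro closed_ball_eq_closed_convex_hull[of e] tangentially_complete_maximal)
        (auto intro: norm_maximal_le_1 maximal_unimodular)
  next
    fix e assume "unitary_tripotent triple e"
    then show "closure (ball 0 1) = closure (convex hull {e. unitary_tripotent triple e})"
      by (intro closed_ball_eq_closed_convex_hull[of e] tangentially_complete_unitary)
        (auto intro: norm_maximal_le_1 unitary_unimodular unitary_imp_maximal)
  qed
qed
end
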